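(* Every SDL topological space with a $G_\delta$ diagonal of rank $2$ has cardinality at most $\mathfrak{c} = 2^{\aleph_0}$.
   Context: A space is Lindelöf if every open cover has a countable subcover. A subset $D$ of a topological space $X$ is strongly discrete if for every $x \in D$ there is an open neighbourhood $U_x \subset X$ of $x$ such that $U_x\cap U_y=\emptyset$ for distinct $x,y\in D$. A space $X$ is SDL if the closure in $X$ of every strongly discrete subset of $X$ is Lindelöf. For a family $\mathcal{U}$ of subsets of $X$ and $F \subset X$ put $St(F,\mathcal{U}) = \bigcup \{U \in \mathcal{U} : F \cap U \neq \emptyset\}$. For $x \in X$ put $St^1(x,\mathcal{U}) = St(x,\mathcal{U}) = St(\{x\},\mathcal{U})$ and $St^n(x,\mathcal{U}) = St(St^{n-1}(x,\mathcal{U}),\mathcal{U})$ for $n > 1$. A space $X$ has a $G_\delta$ diagonal of rank $n$ if there is a sequence $\{\mathcal{U}_k : k < \omega\}$ of open covers of $X$ such that $\bigcap \{St^n(x,\mathcal{U}_k) : k < \omega\} = \{x\}$ for every $x \in X$. *)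

theory Defs
  imports "HOL-Analysis.Analysis" "HOL-Library.Equipollence"
begin

definition strongly_discrete :: "'a topology \<Rightarrow> 'a set \<Rightarrow> bool" where
  "strongly_discrete X D \<longleftrightarrow>
     D \<subseteq> topspace X \<and>
     (\<exists>U. (\<forall>x\<in>D. openin X (U x) \<and> x \<in> U x) \<and>
          (\<forall>x\<in>D. \<forall>y\<in>D. x \<noteq> y \<longrightarrow> U x \<inter> U y = {}))"

definition SDL_space :: "'a topology \<Rightarrow> bool" where
  "SDL_space X \<longleftrightarrow>
     (\<forall>D. strongly_discrete X D \<longrightarrow> Lindelof_space (subtopology X (X closure_of D)))"

definition star :: "'a set \<Rightarrow> 'a set set \<Rightarrow> 'a set" where
  "star F \<U> = \<Union>{U \<in> \<U>. F \<inter> U \<noteq> {}}"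

text \<open>The recursion starts at the auxiliary value \<open>{x}\<close> for \<open>n = 0\<close>, so that
  \<open>n = 1\<close> gives the star of \<open>x\<close>; only \<open>n \<ge> 1\<close> is of interest.\<close>

primrec star_iter :: "nat \<Rightarrow> 'a \<Rightarrow> 'a set set \<Rightarrow> 'a set" where
  "star_iter 0 x \<U> = {x}"
| "star_iter (Suc n) x \<U> = star (star_iter n x \<U>) \<U>"

definition open_cover :: "'a topology \<Rightarrow> 'a set set \<Rightarrow> bool" where
  "open_cover X \<U> \<longleftrightarrow> (\<forall>U\<in>\<U>. openin X U) \<and> \<Union>\<U> = topspace X"

definition has_G_delta_diagonal_of_rank :: "'a topology \<Rightarrow> nat \<Rightarrow> bool" where
  "has_G_delta_diagonal_of_rank X n \<longleftrightarrow>
     (\<exists>\<U> :: nat \<Rightarrow> 'a set set.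
        (\<forall>k. open_cover X (\<U> k)) \<and>
        (\<forall>x\<in>topspace X. (\<Inter>k. star_iter n x (\<U> k)) = {x}))"

end

theory Submission
  imports Defs
begin

text \<open>Two points lie outside each other's second star exactly when their first stars are
  disjoint. A set whose \<open>\<U> k\<close>-stars are pairwise disjoint is therefore strongly discrete, and each
  member of \<open>\<U> k\<close> contains at most one of its points, so SDL makes it countable. Now close off:
  take a set \<open>H\<close> of size at most continuum that contains a point outside
  \<open>\<Union>\<^sub>k St\<^sup>2(D\<^sub>k, \<U> k)\<close> for all countable \<open>D\<^sub>k \<subseteq> H\<close> for which there is one. A point \<open>p\<close> outside
  \<open>H\<close> yields a contradiction: with \<open>D\<^sub>k\<close> a maximal subset of
  \<open>{x \<in> H. p \<notin> St\<^sup>2(x, \<U> k)}\<close> having pairwise disjoint \<open>\<U> k\<close>-stars, the second stars of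
  the \<open>D\<^sub>k\<close> cover \<open>H\<close> but miss \<open>p\<close>.\<close>

text \<open>Formal terms in one operation with countably many optional arguments. Their values form a
  set closed under the operation, and there are at most continuum many of them because a term is
  determined by the set of positions of its nodes.\<close>

datatype term_tree = Node "nat \<Rightarrow> term_tree option"

primrec paths :: "term_tree \<Rightarrow> nat list set" where
  "paths (Node f) = insert [] (\<Union>n. (#) n ` (\<Union>(set_option (map_option paths (f n)))))"

primrec eval_tree :: "((nat \<Rightarrow> 'a option) \<Rightarrow> 'a) \<Rightarrow> term_tree \<Rightarrow> 'a" where
  "eval_tree F (Node f) = F (\<lambda>n. map_option (eval_tree F) (f n))"

lemma Nil_in_paths: "[] \<in> paths t"
  by (cases t) simp

lemma Cons_in_paths_Node: "n # l \<in> paths (Node f) \<longleftrightarrow> (\<exists>t. f n = Some t \<and> l \<in> paths t)"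
  by (auto simp: image_iff)

text \<open>Every path set contains \<open>[]\<close>, so the paths beginning with \<open>n\<close>
  show whether argument \<open>n\<close> is present. If it is, their tails are exactly its paths,
  and induction applies.\<close>

lemma inj_paths: "inj paths"
proof (rule injI)
  show "s = t" if "paths s = paths t" for s t
    using that
  proof (induction s arbitrary: t)
    case (Node f)
    obtain g where t: "t = Node g" by (cases t)
    have eq: "(\<exists>u. f n = Some u \<and> l \<in> paths u) \<longleftrightarrow> (\<exists>u. g n = Some u \<and> l \<in> paths u)" for n l
      using Node.prems unfolding t by (metis Cons_in_paths_Node)
    have "f n = g n" for n
    proof (cases "f n")
      case None
      then show ?thesis
        using eq[of n "[]"] Nil_in_paths by (cases "g n") auto
    next
      case (Some u)
      then obtain v where v: "g n = Some v"
        using eq[of n "[]"] Nil_in_paths by auto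
      have "paths u = paths v"
        using eq[of n] Some v by auto
      then have "u = v"
        by (intro Node.IH[of "f n" u]) (use Some in \<open>auto intro: range_eqI[of _ f n]\<close>)
      with Some v show ?thesis by simp
    qed
    with t show ?case by auto
  qed
qed

lemma exists_closed_set_lepoll_continuum:
  fixes F :: "(nat \<Rightarrow> 'a option) \<Rightarrow> 'a"
  obtains H where "H \<lesssim> (UNIV :: nat set set)"
    and "\<And>s. (\<And>n. set_option (s n) \<subseteq> H) \<Longrightarrow> F s \<in> H"
proof
  \<comment> \<open>Coding positions by naturals turns path sets into elements of
    \<open>nat set\<close>.\<close>
  have "inj (image (to_nat :: nat list \<Rightarrow> nat))"
    by (metis inj_image_eq_iff inj_on_def inj_to_nat)
  then have "inj (image to_nat \<circ> paths)"
    by (intro inj_compose inj_paths)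
  then have "(UNIV :: term_tree set) \<lesssim> (UNIV :: nat set set)"
    unfolding lepoll_def by blast
  then show "range (eval_tree F) \<lesssim> (UNIV :: nat set set)"
    using image_lepoll lepoll_trans by blast
next
  fix s :: "nat \<Rightarrow> 'a option"
  assume s: "\<And>n. set_option (s n) \<subseteq> range (eval_tree F)"
  have "\<exists>u. s n = map_option (eval_tree F) u" for n
  proof (cases "s n")
    case (Some x)
    with s[of n] obtain t where "x = eval_tree F t" by auto
    with Some show ?thesis by (intro exI[of _ "Some t"]) simp
  qed simp
  then obtain f where "\<And>n. s n = map_option (eval_tree F) (f n)" by metis
  then have "s = (\<lambda>n. map_option (eval_tree F) (f n))" by (rule ext)
  then have "F s = eval_tree F (Node f)" by simp
  then show "F s \<in> range (eval_tree F)" by (rule range_eqI)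
qed

text \<open>Zorn's lemma applies because any two points in the union of a chain already lie in one
  member.\<close>

lemma exists_maximal_pairwise:
  obtains D where "D \<subseteq> A" and "pairwise R D"
    and "\<And>x. x \<in> A \<Longrightarrow> pairwise R (insert x D) \<Longrightarrow> x \<in> D"
proof -
  have "\<exists>M\<in>{D. D \<subseteq> A \<and> pairwise R D}. \<forall>E\<in>{D. D \<subseteq> A \<and> pairwise R D}. M \<subseteq> E \<longrightarrow> E = M"
  proof (rule subset_Zorn')
    fix C assume C: "subset.chain {D. D \<subseteq> A \<and> pairwise R D} C"
    then have "pairwise R (\<Union>C)"
      by (intro pairwise_chain_Union) (auto simp: subset_chain_def chain_subset_def)
    with C show "\<Union>C \<in> {D. D \<subseteq> A \<and> pairwise R D}"
      by (auto simp: subset_chain_def)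
  qed
  then obtain D where "D \<in> {D. D \<subseteq> A \<and> pairwise R D}"
    and max: "\<forall>E\<in>{D. D \<subseteq> A \<and> pairwise R D}. D \<subseteq> E \<longrightarrow> E = D"
    by (rule bexE)
  then have D: "D \<subseteq> A" "pairwise R D" by simp_all
  show thesis
  proof (rule that[OF D])
    fix x assume "x \<in> A" "pairwise R (insert x D)"
    with D(1) max have "insert x D = D" by (simp add: subset_insertI)
    then show "x \<in> D" by blast
  qed
qed

text \<open>A member of the cover that contains \<open>y\<close> and meets the star of
  \<open>x\<close> lies in the star of \<open>y\<close>. This form shows the symmetry in
  \<open>x\<close> and \<open>y\<close>.\<close>

lemma mem_star_iter_2:
  "y \<in> star_iter 2 x \<U> \<longleftrightarrow> star {x} \<U> \<inter> star {y} \<U> \<noteq> {}"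
  by (auto simp: star_def numeral_2_eq_2)

lemma mem_star_self: "open_cover X \<U> \<Longrightarrow> x \<in> topspace X \<Longrightarrow> x \<in> star {x} \<U>"
  by (auto simp: star_def open_cover_def)

lemma openin_star: "open_cover X \<U> \<Longrightarrow> openin X (star F \<U>)"
  by (auto simp: star_def open_cover_def)

lemma countable_if_disjoint_stars:
  assumes "SDL_space X" and \<U>: "open_cover X \<U>" and D: "D \<subseteq> topspace X"
    and disj: "pairwise (\<lambda>x y. y \<notin> star_iter 2 x \<U>) D"
  shows "countable D"
proof -
  have "strongly_discrete X D"
    unfolding strongly_discrete_def
    using D disj openin_star[OF \<U>] mem_star_self[OF \<U>]
    by (intro conjI exI[of _ "\<lambda>x. star {x} \<U>"]) (auto simp: pairwise_def mem_star_iter_2)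
  then have "Lindelof_space (subtopology X (X closure_of D))"
    using assms(1) by (simp add: SDL_space_def)
  moreover have "X closure_of D \<subseteq> \<Union>\<U>"
    using \<U> closure_of_subset_topspace by (simp add: open_cover_def)
  ultimately obtain \<V> where \<V>: "countable \<V>" "\<V> \<subseteq> \<U>" "X closure_of D \<subseteq> \<Union>\<V>"
    using \<U> unfolding open_cover_def Lindelof_space_subtopology_subset[OF closure_of_subset_topspace]
    by meson
  have "countable (D \<inter> V)" if "V \<in> \<V>" for V
  proof -
    have "x = y" if "x \<in> D \<inter> V" "y \<in> D \<inter> V" for x y
    proof (rule ccontr)
      assume "x \<noteq> y"
      then have "star {x} \<U> \<inter> star {y} \<U> = {}"
        using disj that by (auto simp: pairwise_def mem_star_iter_2)
      moreover have "x \<in> star {x} \<U> \<inter> star {y} \<U>"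
        using that \<open>V \<in> \<V>\<close> \<V>(2) by (auto simp: star_def)
      ultimately show False by blast
    qed
    \<comment> \<open>The choice is arbitrary if \<open>D \<inter> V\<close> is empty.\<close>
    then have "D \<inter> V \<subseteq> {SOME x. x \<in> D \<inter> V}"
      by (metis singletonI someI subsetI)
    then show ?thesis
      by (rule countable_subset) simp
  qed
  then have "countable (\<Union>V\<in>\<V>. D \<inter> V)"
    using \<V>(1) by blast
  moreover have "D \<subseteq> (\<Union>V\<in>\<V>. D \<inter> V)"
    using \<V>(3) closure_of_subset[OF D] by blast
  ultimately show ?thesis
    using countable_subset by blast
qed

theorem theorem15:
  fixes X :: "'a topology"
  assumes "SDL_space X"
    and "has_G_delta_diagonal_of_rank X 2"
  shows "topspace X \<lesssim> (UNIV :: nat set set)"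
proof -
  obtain \<U> :: "nat \<Rightarrow> 'a set set"
    where \<U>: "\<And>k. open_cover X (\<U> k)"
      and diag: "\<And>x. x \<in> topspace X \<Longrightarrow> (\<Inter>k. star_iter 2 x (\<U> k)) = {x}"
    using assms(2) unfolding has_G_delta_diagonal_of_rank_def by metis
  define star2 where "star2 k D = (\<Union>x\<in>D. star_iter 2 x (\<U> k))" for k D
  \<comment> \<open>Pairing lets one sequence encode countably many sets; \<open>None\<close> allows
    finite or empty ones.\<close>
  define row where "row s k = (\<Union>n. set_option (s (prod_encode (k, n))))"
    for s :: "nat \<Rightarrow> 'a option" and k
  \<comment> \<open>If no point is left, the value is arbitrary and may lie outside the space, hence
    the intersection with \<open>topspace X\<close> in \<open>A\<close> below.\<close>
  define F where "F s = (SOME x. x \<in> topspace X - (\<Union>k. star2 k (row s k)))" for s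
  obtain H where H: "H \<lesssim> (UNIV :: nat set set)"
    and closed: "\<And>s. (\<And>n. set_option (s n) \<subseteq> H) \<Longrightarrow> F s \<in> H"
    using exists_closed_set_lepoll_continuum[of F] by blast
  have "topspace X \<subseteq> H"
  proof (rule ccontr)
    assume "\<not> topspace X \<subseteq> H"
    then obtain p where p: "p \<in> topspace X" "p \<notin> H" by blast
    define A where "A k = {x \<in> H \<inter> topspace X. p \<notin> star_iter 2 x (\<U> k)}" for k
    have "\<exists>D. D \<subseteq> A k \<and> countable D \<and> A k \<subseteq> star2 k D" for k
    proof -
      obtain D where D: "D \<subseteq> A k" "pairwise (\<lambda>x y. y \<notin> star_iter 2 x (\<U> k)) D"
        and max: "\<And>x. x \<in> A k \<Longrightarrow> pairwise (\<lambda>x y. y \<notin> star_iter 2 x (\<U> k)) (insert x D) \<Longrightarrow> x \<in> D"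
        using exists_maximal_pairwise[of "A k" "\<lambda>x y. y \<notin> star_iter 2 x (\<U> k)"] by blast
      have "countable D"
        using assms(1) \<U> D by (intro countable_if_disjoint_stars) (auto simp: A_def)
      moreover have "x \<in> star2 k D" if "x \<in> A k" for x
      proof (cases "x \<in> D")
        case True
        then show ?thesis
          using diag[of x] \<open>x \<in> A k\<close> by (auto simp: star2_def A_def)
      next
        case False
        then have "\<not> pairwise (\<lambda>x y. y \<notin> star_iter 2 x (\<U> k)) (insert x D)"
          using max that by blast
        \<comment> \<open>By symmetry, a conflict of \<open>x\<close> with a point of
          \<open>D\<close> in either order puts \<open>x\<close> in that point's second
          star.\<close>
        then show ?thesis
          using D(2) by (auto simp: pairwise_insert star2_def mem_star_iter_2 Int_commute)
      qed
      ultimately show ?thesis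
        using D(1) by blast
    qed
    then obtain D where D: "\<And>k. D k \<subseteq> A k" "\<And>k. countable (D k)" "\<And>k. A k \<subseteq> star2 k (D k)"
      by metis
    define s where "s m = (case prod_decode m of (k, n) \<Rightarrow>
      if n \<in> to_nat_on (D k) ` D k then Some (from_nat_into (D k) n) else None)" for m
    have row: "row s k = D k" for k
    proof -
      have "row s k = from_nat_into (D k) ` to_nat_on (D k) ` D k"
        by (auto simp: row_def s_def split: if_splits) blast
      then show ?thesis
        using D(2) by (simp add: image_comp)
    qed
    have "D k \<subseteq> H" for k
      using D(1) by (auto simp: A_def)
    moreover have "set_option (s m) \<subseteq> D (fst (prod_decode m))" for m
      using D(2) by (auto simp: s_def split: prod.splits)
    ultimately have "set_option (s m) \<subseteq> H" for m
      by (meson order_trans)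
    then have "F s \<in> H"
      by (rule closed)
    \<comment> \<open>The point \<open>p\<close> witnesses that the choice in \<open>F s\<close> is
      a genuine one.\<close>
    have "p \<in> topspace X - (\<Union>k. star2 k (row s k))"
      using p(1) D(1) by (auto simp: row star2_def A_def)
    then have Fs: "F s \<in> topspace X - (\<Union>k. star2 k (row s k))"
      unfolding F_def by (rule someI)
    \<comment> \<open>The diagonal separates \<open>F s\<close> from \<open>p\<close> at some
      \<open>k\<close>, so \<open>F s\<close> is in \<open>A k\<close>, which the second stars of
      \<open>D k\<close> cover.\<close>
    then have "(\<Inter>k. star_iter 2 (F s) (\<U> k)) = {F s}"
      by (intro diag) simp
    moreover have "p \<noteq> F s"
      using \<open>F s \<in> H\<close> p(2) by metis
    ultimately have "p \<notin> (\<Inter>k. star_iter 2 (F s) (\<U> k))"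
      by simp
    then obtain k where "p \<notin> star_iter 2 (F s) (\<U> k)"
      by auto
    with \<open>F s \<in> H\<close> Fs have "F s \<in> A k"
      by (simp add: A_def)
    with D(3)[of k] Fs show False
      by (auto simp: row)
  qed
  then show ?thesis
    using H subset_imp_lepoll lepoll_trans by blast
qed

end
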